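(* Let $K$ be a field and let $E$ be a graph satisfying condition (K). Let $$X_0=\{v\in E^0 : \text{there exist } e\ne f\in E^1 \text{ with } s(e)=s(f)=v,\ r(e)\ge v,\ r(f)\ge v\},$$ and let $X$ be the hereditary saturated closure of $X_0$. If $L(E)$ has no unital purely infinite simple quotients, then neither has $I(X)$ (regarded as a ring).
   Context: A (directed) graph $E=(E^0,E^1,r,s)$ consists of countable sets $E^0$ (vertices) and $E^1$ (edges) and maps $r,s:E^1\to E^0$ (range and source). All graphs are assumed row-finite: $s^{-1}(v)$ is finite for every $v\in E^0$. A path is a sequence of edges $\mu=(\mu_1,\dots,\mu_n)$ with $r(\mu_i)=s(\mu_{i+1})$; $s(\mu)=s(\mu_1)$, $r(\mu)=r(\mu_n)$; vertices are paths of length $0$. Write $v\ge w$ if there is a path $\mu$ (possibly of length $0$) with $s(\mu)=v$, $r(\mu)=w$. A subset $H\subseteq E^0$ is hereditary if $v\in H$ and $v\ge w$ imply $w\in H$; it is saturated if $s^{-1}(v)\ne\emptyset$ and $r(s^{-1}(v))\subseteq H$ imply $v\in H$. The hereditary saturated closure of a set $Y\subseteq E^0$ is the smallest hereditary and saturated subset of $E^0$ containing $Y$. A closed simple path based at $v$ is a path $\mu=(\mu_1,\dots,\mu_n)$, $n\ge1$, with $s(\mu)=r(\mu)=v$ and $s(\mu_i)\ne v$ for $i>1$. $E$ satisfies condition (K) if for each vertex $v$ on a closed simple path there are at least two distinct closed simple paths based at $v$. The Leavitt path algebra $L(E)=L_K(E)$ is the (not necessarily unital) $K$-algebra generated by a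 set $\{v: v\in E^0\}$ of pairwise orthogonal idempotents together with variables $\{e,e^*: e\in E^1\}$ subject to: $s(e)e=er(e)=e$; $r(e)e^*=e^*s(e)=e^*$; $e^*e'=\delta_{e,e'}r(e)$ for $e,e'\in E^1$; $v=\sum_{s(e)=v}ee^*$ for every $v\in E^0$ that emits edges. For $H\subseteq E^0$, $I(H)$ is the two-sided ideal of $L(E)$ generated by $H$. An idempotent $e$ of a ring $R$ is infinite if $eR$ is isomorphic as a right $R$-module to a proper direct summand of itself. $R$ is purely infinite if every nonzero right ideal of $R$ contains an infinite idempotent. A unital purely infinite simple quotient of a ring $R$ is a quotient $R/J$ by a two-sided ideal $J$ that is unital, simple and purely infinite. *)

theory Defs
  imports
    "Graph_Theory.Arc_Walk"
    "HOL-Library.Countable_Set"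
    "HOL-Library.Poly_Mapping"
    "HOL-Algebra.QuotRing"
begin

text \<open>
  Graphs are records of type \<open>('v, 'e) pre_digraph\<close> from \<open>Graph_Theory\<close>, with source \<open>s = tail\<close>
  and range \<open>r = head\<close>; \<open>awalk v \<mu> w\<close> says that the edge list \<open>\<mu>\<close> is a path, possibly of
  length \<open>0\<close>, from \<open>v\<close> to \<open>w\<close>.
\<close>

definition row_finite :: "('v, 'e) pre_digraph \<Rightarrow> bool" where
  "row_finite E \<longleftrightarrow> (\<forall>v\<in>verts E. finite (out_arcs E v))"

definition connects :: "('v, 'e) pre_digraph \<Rightarrow> 'v \<Rightarrow> 'v \<Rightarrow> bool" where
  "connects E v w \<longleftrightarrow> (\<exists>\<mu>. pre_digraph.awalk E v \<mu> w)"

definition hereditary :: "('v, 'e) pre_digraph \<Rightarrow> 'v set \<Rightarrow> bool" where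
  "hereditary E H \<longleftrightarrow> (\<forall>v\<in>H. \<forall>w. connects E v w \<longrightarrow> w \<in> H)"

definition saturated :: "('v, 'e) pre_digraph \<Rightarrow> 'v set \<Rightarrow> bool" where
  "saturated E H \<longleftrightarrow>
     (\<forall>v\<in>verts E. out_arcs E v \<noteq> {} \<and> head E ` out_arcs E v \<subseteq> H \<longrightarrow> v \<in> H)"

definition hs_closure :: "('v, 'e) pre_digraph \<Rightarrow> 'v set \<Rightarrow> 'v set" where
  "hs_closure E Y = \<Inter>{H. H \<subseteq> verts E \<and> hereditary E H \<and> saturated E H \<and> Y \<subseteq> H}"

definition closed_simple_path :: "('v, 'e) pre_digraph \<Rightarrow> 'v \<Rightarrow> 'e list \<Rightarrow> bool" where
  "closed_simple_path E v \<mu> \<longleftrightarrow>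
     \<mu> \<noteq> [] \<and> pre_digraph.awalk E v \<mu> v \<and> (\<forall>e\<in>set (tl \<mu>). tail E e \<noteq> v)"

definition condition_K :: "('v, 'e) pre_digraph \<Rightarrow> bool" where
  "condition_K E \<longleftrightarrow>
     (\<forall>v. (\<exists>u \<mu>. closed_simple_path E u \<mu> \<and> v \<in> set (pre_digraph.awalk_verts E u \<mu>)) \<longrightarrow>
          (\<exists>\<mu> \<nu>. \<mu> \<noteq> \<nu> \<and> closed_simple_path E v \<mu> \<and> closed_simple_path E v \<nu>))"


section \<open>Not necessarily unital rings\<close>

text \<open>
  Not necessarily unital rings are represented by the \<open>ring\<close> records of \<open>HOL-Algebra\<close>, whose
  field \<open>one\<close> is never used. The locale \<open>ideal\<close> of \<open>HOL-Algebra\<close> requires an identity element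
  and is therefore replaced here; \<open>additive_subgroup\<close> and the quotient \<open>R Quot J\<close> do not depend
  on one (apart from the unused field \<open>one\<close> of the quotient record).
\<close>

definition right_ideal :: "'a set \<Rightarrow> ('a, 'm) ring_scheme \<Rightarrow> bool" where
  "right_ideal A R \<longleftrightarrow>
     additive_subgroup A R \<and> (\<forall>a\<in>A. \<forall>x\<in>carrier R. a \<otimes>\<^bsub>R\<^esub> x \<in> A)"

definition two_sided_ideal :: "'a set \<Rightarrow> ('a, 'm) ring_scheme \<Rightarrow> bool" where
  "two_sided_ideal J R \<longleftrightarrow>
     additive_subgroup J R \<and>
     (\<forall>a\<in>J. \<forall>x\<in>carrier R. x \<otimes>\<^bsub>R\<^esub> a \<in> J \<and> a \<otimes>\<^bsub>R\<^esub> x \<in> J)"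

definition generated_ideal :: "('a, 'm) ring_scheme \<Rightarrow> 'a set \<Rightarrow> 'a set" where
  "generated_ideal R S = \<Inter>{J. two_sided_ideal J R \<and> S \<subseteq> J}"

definition unital :: "('a, 'm) ring_scheme \<Rightarrow> bool" where
  "unital R \<longleftrightarrow>
     (\<exists>u\<in>carrier R. \<forall>x\<in>carrier R. u \<otimes>\<^bsub>R\<^esub> x = x \<and> x \<otimes>\<^bsub>R\<^esub> u = x)"

text \<open>Simplicity includes \<open>R\<^sup>2 \<noteq> 0\<close>, which for a unital ring just says \<open>R \<noteq> 0\<close>.\<close>

definition simple_ring :: "('a, 'm) ring_scheme \<Rightarrow> bool" where
  "simple_ring R \<longleftrightarrow>
     (\<exists>x\<in>carrier R. \<exists>y\<in>carrier R. x \<otimes>\<^bsub>R\<^esub> y \<noteq> \<zero>\<^bsub>R\<^esub>) \<and>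
     (\<forall>J. two_sided_ideal J R \<longrightarrow> J = {\<zero>\<^bsub>R\<^esub>} \<or> J = carrier R)"

text \<open>Isomorphism of right ideals of \<open>R\<close> as right \<open>R\<close>-modules:\<close>

definition right_module_iso :: "('a, 'm) ring_scheme \<Rightarrow> 'a set \<Rightarrow> 'a set \<Rightarrow> bool" where
  "right_module_iso R M N \<longleftrightarrow>
     (\<exists>\<phi>. bij_betw \<phi> M N \<and>
          (\<forall>x\<in>M. \<forall>y\<in>M. \<phi> (x \<oplus>\<^bsub>R\<^esub> y) = \<phi> x \<oplus>\<^bsub>R\<^esub> \<phi> y) \<and>
          (\<forall>x\<in>M. \<forall>r\<in>carrier R. \<phi> (x \<otimes>\<^bsub>R\<^esub> r) = \<phi> x \<otimes>\<^bsub>R\<^esub> r))"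

definition proper_direct_summand :: "('a, 'm) ring_scheme \<Rightarrow> 'a set \<Rightarrow> 'a set \<Rightarrow> bool" where
  "proper_direct_summand R A M \<longleftrightarrow>
     A \<noteq> M \<and> right_ideal A R \<and>
     (\<exists>B. right_ideal B R \<and> A <+>\<^bsub>R\<^esub> B = M \<and> A \<inter> B = {\<zero>\<^bsub>R\<^esub>})"

definition infinite_idempotent :: "('a, 'm) ring_scheme \<Rightarrow> 'a \<Rightarrow> bool" where
  "infinite_idempotent R e \<longleftrightarrow>
     e \<in> carrier R \<and> e \<otimes>\<^bsub>R\<^esub> e = e \<and>
     (\<exists>A. proper_direct_summand R A (e <#\<^bsub>R\<^esub> carrier R) \<and>
          right_module_iso R (e <#\<^bsub>R\<^esub> carrier R) A)"

definition purely_infinite :: "('a, 'm) ring_scheme \<Rightarrow> bool" where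
  "purely_infinite R \<longleftrightarrow>
     (\<forall>A. right_ideal A R \<and> A \<noteq> {\<zero>\<^bsub>R\<^esub>} \<longrightarrow> (\<exists>e\<in>A. infinite_idempotent R e))"

definition has_unital_pi_simple_quotient :: "('a, 'm) ring_scheme \<Rightarrow> bool" where
  "has_unital_pi_simple_quotient R \<longleftrightarrow>
     (\<exists>J. two_sided_ideal J R \<and>
          unital (R Quot J) \<and> simple_ring (R Quot J) \<and> purely_infinite (R Quot J))"


section \<open>Leavitt path algebras\<close>

datatype 'g free_monoid = Word (letters: "'g list")

instantiation free_monoid :: (type) monoid_add
begin

definition zero_free_monoid :: "'a free_monoid" where
  "0 = Word []"

definition plus_free_monoid :: "'a free_monoid \<Rightarrow> 'a free_monoid \<Rightarrow> 'a free_monoid" where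
  "x + y = Word (letters x @ letters y)"

instance
  by standard (simp_all add: zero_free_monoid_def plus_free_monoid_def)

end

text \<open>
  \<open>'g free_monoid \<Rightarrow>\<^sub>0 'k\<close> is the free unital algebra on the type \<open>'g\<close>. The free non-unital algebra
  on \<open>G\<close> is its subset of all linear combinations of nonempty words in \<open>G\<close>.
\<close>

type_synonym ('g, 'k) free_alg = "'g free_monoid \<Rightarrow>\<^sub>0 'k"

definition free_algebra :: "'k::field itself \<Rightarrow> 'g set \<Rightarrow> ('g, 'k) free_alg ring" where
  "free_algebra K G =
     \<lparr>carrier = {p. \<forall>w\<in>Poly_Mapping.keys p. letters w \<noteq> [] \<and> set (letters w) \<subseteq> G},
      mult = (*), one = undefined, zero = 0, add = (+)\<rparr>"

definition monom :: "'g list \<Rightarrow> ('g, 'k::field) free_alg" where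
  "monom gs = Poly_Mapping.single (Word gs) 1"

definition generated_algebra_ideal ::
  "'k::field itself \<Rightarrow> 'g set \<Rightarrow> ('g, 'k) free_alg set \<Rightarrow> ('g, 'k) free_alg set" where
  "generated_algebra_ideal K G S =
     \<Inter>{J. two_sided_ideal J (free_algebra K G) \<and>
          (\<forall>c. \<forall>p\<in>J. Poly_Mapping.map ((*) c) p \<in> J) \<and> S \<subseteq> J}"

datatype ('v, 'e) lpa_gen = Vertex 'v | Edge 'e | Ghost 'e

definition lpa_gens :: "('v, 'e) pre_digraph \<Rightarrow> ('v, 'e) lpa_gen set" where
  "lpa_gens E = Vertex ` verts E \<union> Edge ` arcs E \<union> Ghost ` arcs E"

text \<open>Each element \<open>p - q\<close> below stands for the relation \<open>p = q\<close>.\<close>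

definition lpa_relations ::
  "'k::field itself \<Rightarrow> ('v, 'e) pre_digraph \<Rightarrow> (('v, 'e) lpa_gen, 'k) free_alg set" where
  "lpa_relations K E =
     {monom [Vertex v, Vertex w] - (if v = w then monom [Vertex v] else 0) | v w.
        v \<in> verts E \<and> w \<in> verts E} \<union>
     {monom [Vertex (tail E e), Edge e] - monom [Edge e] | e. e \<in> arcs E} \<union>
     {monom [Edge e, Vertex (head E e)] - monom [Edge e] | e. e \<in> arcs E} \<union>
     {monom [Vertex (head E e), Ghost e] - monom [Ghost e] | e. e \<in> arcs E} \<union>
     {monom [Ghost e, Vertex (tail E e)] - monom [Ghost e] | e. e \<in> arcs E} \<union>
     {monom [Ghost e, Edge f] - (if e = f then monom [Vertex (head E e)] else 0) | e f.
        e \<in> arcs E \<and> f \<in> arcs E} \<union>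
     {monom [Vertex v] - (\<Sum>e\<in>out_arcs E v. monom [Edge e, Ghost e]) | v.
        v \<in> verts E \<and> out_arcs E v \<noteq> {}}"

abbreviation lpa_ideal ::
  "'k::field itself \<Rightarrow> ('v, 'e) pre_digraph \<Rightarrow> (('v, 'e) lpa_gen, 'k) free_alg set" where
  "lpa_ideal K E \<equiv> generated_algebra_ideal K (lpa_gens E) (lpa_relations K E)"

text \<open>Only the ring structure of the algebra \<open>L\<^sub>K(E)\<close> is recorded.\<close>

definition leavitt_path_algebra ::
  "'k::field itself \<Rightarrow> ('v, 'e) pre_digraph \<Rightarrow> (('v, 'e) lpa_gen, 'k) free_alg set ring" where
  "leavitt_path_algebra K E = free_algebra K (lpa_gens E) Quot lpa_ideal K E"

definition lpa_vertex ::
  "'k::field itself \<Rightarrow> ('v, 'e) pre_digraph \<Rightarrow> 'v \<Rightarrow> (('v, 'e) lpa_gen, 'k) free_alg set" where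
  "lpa_vertex K E v = lpa_ideal K E +>\<^bsub>free_algebra K (lpa_gens E)\<^esub> monom [Vertex v]"

definition vertex_ideal ::
  "'k::field itself \<Rightarrow> ('v, 'e) pre_digraph \<Rightarrow> 'v set \<Rightarrow> (('v, 'e) lpa_gen, 'k) free_alg set set"
  where
  "vertex_ideal K E H = generated_ideal (leavitt_path_algebra K E) (lpa_vertex K E ` H)"

definition vertex_ideal_ring ::
  "'k::field itself \<Rightarrow> ('v, 'e) pre_digraph \<Rightarrow> 'v set \<Rightarrow> (('v, 'e) lpa_gen, 'k) free_alg set ring"
  where
  "vertex_ideal_ring K E H = leavitt_path_algebra K E\<lparr>carrier := vertex_ideal K E H\<rparr>"

end

theory Submission
  imports Defs
begin

text \<open>
  The result is an instance of a fact about arbitrary non-unital rings: if \<open>I\<close> is a two-sided ideal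
  of \<open>R\<close>, then every unital quotient of the ring \<open>I\<close> is also a quotient of \<open>R\<close>. Let \<open>q\<close> map \<open>I\<close>
  homomorphically onto a unital ring \<open>S\<close>, and choose \<open>u \<in> I\<close> with \<open>q u = 1\<close>. Then \<open>u a \<in> I\<close> for all
  \<open>a \<in> R\<close>, and \<open>f a = q (u a)\<close> defines an additive extension of \<open>q\<close> to \<open>R\<close>. It is multiplicative,
  because an element of \<open>R\<close> becomes an element of \<open>I\<close> once it is multiplied by \<open>u\<close>, on either side,
  while \<open>q u\<close> can be inserted and deleted freely in \<open>S\<close> (\<open>extend_hom_from_ideal\<close>). By the first
  isomorphism theorem (\<open>Quot_kernel_iso\<close>), \<open>S\<close> is isomorphic to \<open>R / ker f\<close>.

  For \<open>S = I / J\<close> unital, simple and purely infinite, these three properties pass along the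
  isomorphism to the quotient \<open>R / ker f\<close> (\<open>has_unital_pi_simple_quotient_if_ideal_has\<close>). The
  theorem is the case \<open>R = L(E)\<close> and \<open>I = I(X)\<close>, read contrapositively. Here \<open>L(E)\<close> is a ring because
  its defining relations lie in the free algebra, and \<open>I(X)\<close> is an ideal of it because \<open>X\<close> consists
  of vertices.
\<close>

section \<open>Non-unital rings, ideals and quotients\<close>

text \<open>
  The locale \<open>ring\<close> does not apply to quotients, ideals and the free algebra, because their field
  \<open>one\<close> is arbitrary; hence this version, whose assumptions do not mention that field.
\<close>

locale nonunital_ring = abelian_group R for R (structure) +
  assumes m_closed [intro, simp]:
      "\<lbrakk>x \<in> carrier R; y \<in> carrier R\<rbrakk> \<Longrightarrow> x \<otimes> y \<in> carrier R"
    and m_assoc: "\<lbrakk>x \<in> carrier R; y \<in> carrier R; z \<in> carrier R\<rbrakk> \<Longrightarrow>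
      (x \<otimes> y) \<otimes> z = x \<otimes> (y \<otimes> z)"
    and l_distr: "\<lbrakk>x \<in> carrier R; y \<in> carrier R; z \<in> carrier R\<rbrakk> \<Longrightarrow>
      (x \<oplus> y) \<otimes> z = x \<otimes> z \<oplus> y \<otimes> z"
    and r_distr: "\<lbrakk>x \<in> carrier R; y \<in> carrier R; z \<in> carrier R\<rbrakk> \<Longrightarrow>
      z \<otimes> (x \<oplus> y) = z \<otimes> x \<oplus> z \<otimes> y"
begin

lemma l_null [simp]: "x \<in> carrier R \<Longrightarrow> \<zero> \<otimes> x = \<zero>"
  using l_distr[of \<zero> \<zero> x] by (simp add: add.l_cancel_one')

lemma r_null [simp]: "x \<in> carrier R \<Longrightarrow> x \<otimes> \<zero> = \<zero>"
  using r_distr[of \<zero> \<zero> x] by (simp add: add.l_cancel_one')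

lemma additive_subgroupI:
  assumes "A \<subseteq> carrier R" "\<zero> \<in> A"
    and "\<And>x y. x \<in> A \<Longrightarrow> y \<in> A \<Longrightarrow> x \<oplus> y \<in> A"
    and "\<And>x. x \<in> A \<Longrightarrow> \<ominus> x \<in> A"
  shows "additive_subgroup A R"
  by (rule additive_subgroup.intro, rule add.subgroupI) (use assms in auto)

lemma two_sided_ideal_carrier: "two_sided_ideal (carrier R) R"
  unfolding two_sided_ideal_def by (auto intro: additive_subgroupI)

lemma two_sided_ideal_Inter:
  assumes "\<J> \<noteq> {}" and "\<And>J. J \<in> \<J> \<Longrightarrow> two_sided_ideal J R"
  shows "two_sided_ideal (\<Inter>\<J>) R"
  unfolding two_sided_ideal_def
proof (intro conjI ballI)
  have J: "additive_subgroup J R" if "J \<in> \<J>" for J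
    using assms(2)[OF that] by (simp add: two_sided_ideal_def)
  show "additive_subgroup (\<Inter>\<J>) R"
  proof (rule additive_subgroupI)
    show "\<Inter>\<J> \<subseteq> carrier R"
      using assms(1) J[THEN additive_subgroup.a_subset] by blast
  qed (auto dest: J intro: additive_subgroup.zero_closed additive_subgroup.a_closed
      additive_subgroup.a_inv_closed)
qed (use assms(2) in \<open>auto simp: two_sided_ideal_def\<close>)

lemma two_sided_ideal_generated_ideal:
  assumes "S \<subseteq> carrier R"
  shows "two_sided_ideal (generated_ideal R S) R"
  unfolding generated_ideal_def
  by (rule two_sided_ideal_Inter) (use assms two_sided_ideal_carrier in auto)

lemma two_sided_ideal_nonunital_ring:
  assumes "two_sided_ideal I R"
  shows "nonunital_ring (R\<lparr>carrier := I\<rparr>)"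
proof -
  interpret additive_subgroup I R
    using assms by (simp add: two_sided_ideal_def)
  have I [simp]: "x \<in> carrier R" if "x \<in> I" for x
    using that a_subset by blast
  have "abelian_group (R\<lparr>carrier := I\<rparr>)"
  proof (rule abelian_groupI)
    show "\<exists>y\<in>carrier (R\<lparr>carrier := I\<rparr>). y \<oplus>\<^bsub>R\<lparr>carrier := I\<rparr>\<^esub> x = \<zero>\<^bsub>R\<lparr>carrier := I\<rparr>\<^esub>"
      if "x \<in> carrier (R\<lparr>carrier := I\<rparr>)" for x
      using that by (intro bexI[of _ "\<ominus> x"]) (simp_all add: l_neg)
  qed (auto simp: a_ac)
  then show ?thesis
    using assms
    by (auto simp: nonunital_ring_def nonunital_ring_axioms_def two_sided_ideal_def
        m_assoc l_distr r_distr)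
qed

text \<open>
  Representatives \<open>i + x\<close> and \<open>j + y\<close> of two cosets have the product
  \<open>(i (j + y) + x j) + x y\<close>, whose bracket lies in \<open>J\<close> since \<open>J\<close> absorbs multiplication on both
  sides. So all the cosets united in \<open>rcoset_mult\<close> coincide.
\<close>

lemma rcoset_mult_coset:
  assumes J: "two_sided_ideal J R" and x: "x \<in> carrier R" and y: "y \<in> carrier R"
  shows "rcoset_mult R J (J +> x) (J +> y) = J +> (x \<otimes> y)"
proof -
  interpret abelian_subgroup J R
    using J abelian_group_axioms by (auto simp: two_sided_ideal_def intro: abelian_subgroupI3)
  have eq: "J +> (a \<otimes> b) = J +> (x \<otimes> y)" if "a \<in> J +> x" "b \<in> J +> y" for a b
  proof -
    obtain i j where ij: "i \<in> J" "j \<in> J" and ab: "a = i \<oplus> x" "b = j \<oplus> y"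
      using \<open>a \<in> J +> x\<close> \<open>b \<in> J +> y\<close> by (auto simp: a_r_coset_def')
    have "a \<otimes> b = (i \<otimes> b \<oplus> x \<otimes> j) \<oplus> x \<otimes> y"
      using ij x y by (simp add: ab l_distr r_distr a_ac)
    moreover have "i \<otimes> b \<oplus> x \<otimes> j \<in> J"
      using J ij x y by (auto simp: ab two_sided_ideal_def)
    ultimately have "a \<otimes> b \<in> J +> (x \<otimes> y)"
      by (auto simp: a_r_coset_def')
    then show ?thesis
      using a_repr_independence' x y by (metis m_closed)
  qed
  have "x \<in> J +> x" "y \<in> J +> y"
    using x y by (auto intro: a_rcos_self)
  then show ?thesis
    unfolding rcoset_mult_def using eq by blast
qed

lemma nonunital_ring_Quot:
  assumes J: "two_sided_ideal J R"
  shows "nonunital_ring (R Quot J)"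
proof -
  interpret abelian_subgroup J R
    using J abelian_group_axioms by (auto simp: two_sided_ideal_def intro: abelian_subgroupI3)
  have "abelian_group (R Quot J)"
    by (rule comm_group_abelian_groupI)
      (simp add: FactRing_def a_factorgroup_is_comm_group[unfolded A_FactGroup_def'])
  then show ?thesis
    by (auto simp: nonunital_ring_def nonunital_ring_axioms_def FactRing_simps
        rcoset_mult_coset[OF J] a_rcos_sum m_assoc l_distr r_distr)
qed

end


section \<open>Homomorphisms and isomorphisms of non-unital rings\<close>

locale nonunital_ring_hom = R: nonunital_ring R + S: nonunital_ring S
  for R (structure) and S (structure) +
  fixes h
  assumes closed [simp]: "x \<in> carrier R \<Longrightarrow> h x \<in> carrier S"
    and add [simp]: "\<lbrakk>x \<in> carrier R; y \<in> carrier R\<rbrakk> \<Longrightarrow> h (x \<oplus> y) = h x \<oplus>\<^bsub>S\<^esub> h y"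
    and mult [simp]: "\<lbrakk>x \<in> carrier R; y \<in> carrier R\<rbrakk> \<Longrightarrow> h (x \<otimes> y) = h x \<otimes>\<^bsub>S\<^esub> h y"
begin

lemma is_abelian_group_hom: "abelian_group_hom R S h"
proof (rule abelian_group_homI)
  show "group_hom (add_monoid R) (add_monoid S) h"
    by (intro group_hom.intro R.a_group S.a_group group_hom_axioms.intro)
      (auto simp: hom_def)
qed (rule R.abelian_group_axioms S.abelian_group_axioms)+

sublocale abelian_group_hom R S h
  by (rule is_abelian_group_hom)

lemma mem_kernel_iff: "x \<in> a_kernel R S h \<longleftrightarrow> x \<in> carrier R \<and> h x = \<zero>\<^bsub>S\<^esub>"
  unfolding a_kernel_def' by blast

lemma two_sided_ideal_kernel: "two_sided_ideal (a_kernel R S h) R"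
  unfolding two_sided_ideal_def
  by (intro conjI ballI additive_subgroup_a_kernel) (simp_all add: mem_kernel_iff)

lemma kernel_coset_eq_fibre:
  assumes x: "x \<in> carrier R"
  shows "a_kernel R S h +> x = {y \<in> carrier R. h y = h x}"
proof -
  interpret k: abelian_subgroup "a_kernel R S h" R
    by (rule abelian_subgroup_a_kernel)
  have "y \<in> a_kernel R S h +> x \<longleftrightarrow> h y = h x" if y: "y \<in> carrier R" for y
  proof -
    have "y \<in> a_kernel R S h +> x \<longleftrightarrow> h y \<oplus>\<^bsub>S\<^esub> \<ominus>\<^bsub>S\<^esub> h x = \<zero>\<^bsub>S\<^esub>"
      unfolding k.a_rcos_module[OF x y] mem_kernel_iff using x y by simp
    also have "\<dots> \<longleftrightarrow> h y = h x"
      using S.add.inv_solve_right'[of "\<zero>\<^bsub>S\<^esub>" "h y" "h x"] x y by simp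
    finally show ?thesis .
  qed
  then show ?thesis
    using x k.a_elemrcos_carrier by blast
qed

lemma additive_subgroup_image:
  assumes "additive_subgroup A R"
  shows "additive_subgroup (h ` A) S"
proof -
  interpret A: additive_subgroup A R by fact
  have [simp]: "x \<in> carrier R" if "x \<in> A" for x
    using that A.a_subset by blast
  show ?thesis
  proof (rule S.additive_subgroupI)
    show "\<zero>\<^bsub>S\<^esub> \<in> h ` A"
      by (rule image_eqI[of _ _ \<zero>]) simp_all
  next
    fix x y assume "x \<in> h ` A" "y \<in> h ` A"
    then obtain a b where "a \<in> A" "b \<in> A" "x = h a" "y = h b" by blast
    then show "x \<oplus>\<^bsub>S\<^esub> y \<in> h ` A"
      by (intro image_eqI[of _ _ "a \<oplus> b"]) simp_all
  next
    fix x assume "x \<in> h ` A"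
    then obtain a where "a \<in> A" "x = h a" by blast
    then show "\<ominus>\<^bsub>S\<^esub> x \<in> h ` A"
      by (intro image_eqI[of _ _ "\<ominus> a"]) simp_all
  qed auto
qed

lemma image_set_add:
  assumes "A \<subseteq> carrier R" "B \<subseteq> carrier R"
  shows "h ` (A <+> B) = h ` A <+>\<^bsub>S\<^esub> h ` B"
proof -
  have "h (a \<oplus> b) = h a \<oplus>\<^bsub>S\<^esub> h b" if "a \<in> A" "b \<in> B" for a b
    using that assms by (intro add) auto
  then show ?thesis
    by (auto simp: set_add_def' image_UN)
qed

end

text \<open>
  The transfer of simplicity and pure infiniteness needs ideals to be pulled back from \<open>S\<close> to \<open>R\<close>.
  Since the inverse of an isomorphism is again one, images under \<open>h_inv\<close> serve as preimages, and
  it is enough to show that images of ideals are ideals.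
\<close>

locale nonunital_ring_iso = nonunital_ring_hom +
  assumes bij: "bij_betw h (carrier R) (carrier S)"
begin

lemma image_carrier: "h ` carrier R = carrier S"
  using bij by (rule bij_betw_imp_surj_on)

lemma inj_on_carrier: "inj_on h (carrier R)"
  using bij by (rule bij_betw_imp_inj_on)

abbreviation h_inv where "h_inv \<equiv> inv_into (carrier R) h"

lemma h_inv_closed [simp]: "y \<in> carrier S \<Longrightarrow> h_inv y \<in> carrier R"
  using image_carrier by (auto intro: inv_into_into)

lemma h_h_inv [simp]: "y \<in> carrier S \<Longrightarrow> h (h_inv y) = y"
  using image_carrier by (auto intro: f_inv_into_f)

lemma h_inv_h [simp]: "x \<in> carrier R \<Longrightarrow> h_inv (h x) = x"
  by (rule inv_into_f_f[OF inj_on_carrier])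

lemma nonunital_ring_iso_inverse: "nonunital_ring_iso S R h_inv"
proof unfold_locales
  fix x y assume xy: "x \<in> carrier S" "y \<in> carrier S"
  then have "h_inv (h (h_inv x \<oplus> h_inv y)) = h_inv x \<oplus> h_inv y"
    by (intro h_inv_h) simp
  then show "h_inv (x \<oplus>\<^bsub>S\<^esub> y) = h_inv x \<oplus> h_inv y"
    using xy by simp
  have "h_inv (h (h_inv x \<otimes> h_inv y)) = h_inv x \<otimes> h_inv y"
    using xy by (intro h_inv_h) simp
  then show "h_inv (x \<otimes>\<^bsub>S\<^esub> y) = h_inv x \<otimes> h_inv y"
    using xy by simp
qed (auto intro: bij_betw_inv_into[OF bij])

lemma right_ideal_image:
  assumes "right_ideal A R"
  shows "right_ideal (h ` A) S"
  unfolding right_ideal_def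
proof (intro conjI ballI)
  show "additive_subgroup (h ` A) S"
    using assms by (auto simp: right_ideal_def intro: additive_subgroup_image)
  fix a x assume "a \<in> h ` A" "x \<in> carrier S"
  then obtain b where b: "b \<in> A" "a = h b" by blast
  moreover have "b \<in> carrier R"
    using b assms by (auto simp: right_ideal_def dest: additive_subgroup.a_subset)
  ultimately show "a \<otimes>\<^bsub>S\<^esub> x \<in> h ` A"
    using assms \<open>x \<in> carrier S\<close>
    by (intro image_eqI[of _ _ "b \<otimes> h_inv x"]) (simp_all add: right_ideal_def)
qed

lemma two_sided_ideal_image:
  assumes "two_sided_ideal A R"
  shows "two_sided_ideal (h ` A) S"
  unfolding two_sided_ideal_def
proof (intro conjI ballI)
  show "additive_subgroup (h ` A) S"
    using assms by (auto simp: two_sided_ideal_def intro: additive_subgroup_image)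
  fix a x assume "a \<in> h ` A" and x: "x \<in> carrier S"
  then obtain b where b: "b \<in> A" "a = h b" by blast
  moreover have "b \<in> carrier R"
    using b assms by (auto simp: two_sided_ideal_def dest: additive_subgroup.a_subset)
  ultimately have "a \<otimes>\<^bsub>S\<^esub> x = h (b \<otimes> h_inv x)" "x \<otimes>\<^bsub>S\<^esub> a = h (h_inv x \<otimes> b)"
    and "b \<otimes> h_inv x \<in> A" "h_inv x \<otimes> b \<in> A"
    using assms x by (simp_all add: two_sided_ideal_def)
  then show "a \<otimes>\<^bsub>S\<^esub> x \<in> h ` A" "x \<otimes>\<^bsub>S\<^esub> a \<in> h ` A"
    by blast+
qed

lemma proper_direct_summand_image:
  assumes "proper_direct_summand R A M" and M: "M \<subseteq> carrier R"
  shows "proper_direct_summand S (h ` A) (h ` M)"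
proof -
  obtain B where A: "A \<noteq> M" "right_ideal A R" and B: "right_ideal B R"
    and AB: "A <+> B = M" "A \<inter> B = {\<zero>}"
    using assms by (auto simp: proper_direct_summand_def)
  have sub: "A \<subseteq> carrier R" "B \<subseteq> carrier R"
    using A B by (auto simp: right_ideal_def dest: additive_subgroup.a_subset)
  have "h ` A \<noteq> h ` M"
    using A(1) M sub inj_on_image_eq_iff[OF inj_on_carrier] by blast
  moreover have "h ` A <+>\<^bsub>S\<^esub> h ` B = h ` M"
    using AB(1) image_set_add[OF sub] by simp
  moreover have "h ` A \<inter> h ` B = {\<zero>\<^bsub>S\<^esub>}"
    using AB(2) inj_on_image_Int[OF inj_on_carrier sub] by simp
  ultimately show ?thesis
    using A(2) B by (auto simp: proper_direct_summand_def intro: right_ideal_image)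
qed

lemma right_module_iso_image:
  assumes "right_module_iso R M N" and MN: "M \<subseteq> carrier R" "N \<subseteq> carrier R"
  shows "right_module_iso S (h ` M) (h ` N)"
proof -
  obtain \<phi> where \<phi>: "bij_betw \<phi> M N"
    and add_\<phi>: "\<And>x y. x \<in> M \<Longrightarrow> y \<in> M \<Longrightarrow> \<phi> (x \<oplus> y) = \<phi> x \<oplus> \<phi> y"
    and mult_\<phi>: "\<And>x r. x \<in> M \<Longrightarrow> r \<in> carrier R \<Longrightarrow> \<phi> (x \<otimes> r) = \<phi> x \<otimes> r"
    using assms(1) unfolding right_module_iso_def by blast
  have M: "x \<in> carrier R" "\<phi> x \<in> carrier R" if "x \<in> M" for x
    using that MN bij_betwE[OF \<phi>] by auto
  \<comment> \<open>The module isomorphism is conjugated by \<open>h\<close>; scalars from \<open>S\<close> act through \<open>h_inv\<close>.\<close>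
  define \<psi> where "\<psi> = h \<circ> \<phi> \<circ> h_inv"
  have \<psi>: "\<psi> (h x) = h (\<phi> x)" if "x \<in> carrier R" for x
    using that by (simp add: \<psi>_def)
  have "bij_betw h_inv (h ` M) M"
    by (rule bij_betw_byWitness[where f' = h]) (use M in auto)
  moreover have "bij_betw h N (h ` N)"
    using inj_on_subset[OF inj_on_carrier MN(2)] by (rule inj_on_imp_bij_betw)
  ultimately have "bij_betw \<psi> (h ` M) (h ` N)"
    unfolding \<psi>_def using \<phi> by (blast intro: bij_betw_trans)
  moreover have "\<psi> (h x \<oplus>\<^bsub>S\<^esub> h y) = \<psi> (h x) \<oplus>\<^bsub>S\<^esub> \<psi> (h y)" if "x \<in> M" "y \<in> M" for x y
    using that M add_\<phi> \<psi>[of "x \<oplus> y"] by (simp add: \<psi>)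
  moreover have "\<psi> (h x \<otimes>\<^bsub>S\<^esub> r) = \<psi> (h x) \<otimes>\<^bsub>S\<^esub> r" if "x \<in> M" "r \<in> carrier S" for x r
    using that M mult_\<phi> \<psi>[of "x \<otimes> h_inv r"] by (simp add: \<psi>)
  ultimately show ?thesis
    unfolding right_module_iso_def by blast
qed

lemma image_principal_right_ideal:
  assumes "e \<in> carrier R"
  shows "h ` (e <# carrier R) = h e <#\<^bsub>S\<^esub> carrier S"
  using assms by (auto simp: l_coset_def image_UN image_carrier[symmetric])

lemma infinite_idempotent_image:
  assumes "infinite_idempotent R e"
  shows "infinite_idempotent S (h e)"
proof -
  obtain A where e: "e \<in> carrier R" "e \<otimes> e = e"
    and A: "proper_direct_summand R A (e <# carrier R)"
    and iso: "right_module_iso R (e <# carrier R) A"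
    using assms by (auto simp: infinite_idempotent_def)
  have M: "e <# carrier R \<subseteq> carrier R"
    using e by (auto simp: l_coset_def)
  have "A \<subseteq> carrier R"
    using A by (auto simp: proper_direct_summand_def right_ideal_def
        dest: additive_subgroup.a_subset)
  then have "right_module_iso S (h e <#\<^bsub>S\<^esub> carrier S) (h ` A)"
    using right_module_iso_image[OF iso M] image_principal_right_ideal[OF e(1)] by simp
  moreover have "proper_direct_summand S (h ` A) (h e <#\<^bsub>S\<^esub> carrier S)"
    using proper_direct_summand_image[OF A M] image_principal_right_ideal[OF e(1)] by simp
  moreover have "h e \<otimes>\<^bsub>S\<^esub> h e = h e"
    using mult[OF e(1) e(1)] e(2) by simp
  ultimately show ?thesis
    using e(1) by (auto simp: infinite_idempotent_def)
qed

lemma unital_transfer: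
  assumes "unital R"
  shows "unital S"
proof -
  obtain u where u: "u \<in> carrier R" "\<And>x. x \<in> carrier R \<Longrightarrow> u \<otimes> x = x \<and> x \<otimes> u = x"
    using assms by (auto simp: unital_def)
  have "h u \<otimes>\<^bsub>S\<^esub> h x = h x \<and> h x \<otimes>\<^bsub>S\<^esub> h u = h x" if "x \<in> carrier R" for x
    using u that by (simp flip: mult)
  then show ?thesis
    using closed[OF u(1)] unfolding unital_def image_carrier[symmetric] by blast
qed

lemma simple_ring_transfer:
  assumes "simple_ring R"
  shows "simple_ring S"
proof -
  interpret inv: nonunital_ring_iso S R h_inv
    by (rule nonunital_ring_iso_inverse)
  obtain x y where xy: "x \<in> carrier R" "y \<in> carrier R" "x \<otimes> y \<noteq> \<zero>"
    using assms by (auto simp: simple_ring_def)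
  then have "h x \<otimes>\<^bsub>S\<^esub> h y \<noteq> \<zero>\<^bsub>S\<^esub>"
    using inj_onD[OF inj_on_carrier, of "x \<otimes> y" \<zero>] by auto
  moreover have "J = {\<zero>\<^bsub>S\<^esub>} \<or> J = carrier S" if J: "two_sided_ideal J S" for J
  proof -
    have "J \<subseteq> carrier S"
      using J by (auto simp: two_sided_ideal_def dest: additive_subgroup.a_subset)
    then have "h ` h_inv ` J = J"
      by (force simp: image_image)
    moreover have "h_inv ` J = {\<zero>} \<or> h_inv ` J = carrier R"
      using assms inv.two_sided_ideal_image[OF J] by (simp add: simple_ring_def)
    ultimately show ?thesis
      using image_carrier by force
  qed
  ultimately show ?thesis
    using closed[OF xy(1)] closed[OF xy(2)] unfolding simple_ring_def by blast
qed

lemma purely_infinite_transfer: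
  assumes "purely_infinite R"
  shows "purely_infinite S"
  unfolding purely_infinite_def
proof (intro allI impI, elim conjE)
  interpret inv: nonunital_ring_iso S R h_inv
    by (rule nonunital_ring_iso_inverse)
  fix A assume A: "right_ideal A S" "A \<noteq> {\<zero>\<^bsub>S\<^esub>}"
  have "A \<subseteq> carrier S"
    using A(1) by (auto simp: right_ideal_def dest: additive_subgroup.a_subset)
  then have hA: "h ` h_inv ` A = A"
    by (force simp: image_image)
  with A(2) have "h_inv ` A \<noteq> {\<zero>}"
    by force
  then obtain e where "e \<in> h_inv ` A" "infinite_idempotent R e"
    using assms inv.right_ideal_image[OF A(1)] unfolding purely_infinite_def by blast
  then show "\<exists>e\<in>A. infinite_idempotent S e"
    using hA infinite_idempotent_image by blast
qed

end


section \<open>Unital simple quotients of an ideal\<close>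

lemma (in nonunital_ring) coset_hom:
  assumes J: "two_sided_ideal J R"
  shows "nonunital_ring_hom R (R Quot J) (\<lambda>x. J +> x)"
    and "(\<lambda>x. J +> x) ` carrier R = carrier (R Quot J)"
proof -
  interpret abelian_subgroup J R
    using J abelian_group_axioms by (auto simp: two_sided_ideal_def intro: abelian_subgroupI3)
  show "nonunital_ring_hom R (R Quot J) (\<lambda>x. J +> x)"
    by (intro nonunital_ring_hom.intro nonunital_ring_axioms nonunital_ring_Quot J
        nonunital_ring_hom_axioms.intro)
      (auto simp: FactRing_simps rcoset_mult_coset[OF J] a_rcos_sum)
  show "(\<lambda>x. J +> x) ` carrier R = carrier (R Quot J)"
    by (auto simp: FactRing_simps)
qed

text \<open>
  The first isomorphism theorem, stated in the direction in which properties are transferred. The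
  inverse of the induced map \<open>R / ker h \<rightarrow> S\<close> sends each element to its fibre, which is a coset of the
  kernel; no representatives have to be chosen.
\<close>

lemma (in nonunital_ring_hom) Quot_kernel_iso:
  assumes surj: "h ` carrier R = carrier S"
  shows "nonunital_ring_iso S (R Quot a_kernel R S h) (\<lambda>y. {x \<in> carrier R. h x = y})"
proof -
  let ?N = "a_kernel R S h" and ?fib = "\<lambda>y. {x \<in> carrier R. h x = y}"
  interpret Q: nonunital_ring_hom R "R Quot ?N" "\<lambda>x. ?N +> x"
    by (rule R.coset_hom[OF two_sided_ideal_kernel])
  have fib: "?fib (h x) = ?N +> x" if "x \<in> carrier R" for x
    using kernel_coset_eq_fibre[OF that] by simp
  have S: "\<exists>x\<in>carrier R. y = h x" if "y \<in> carrier S" for y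
    using that surj by blast
  show ?thesis
  proof (intro nonunital_ring_iso.intro nonunital_ring_hom.intro nonunital_ring_hom_axioms.intro
      nonunital_ring_iso_axioms.intro S.nonunital_ring_axioms Q.S.nonunital_ring_axioms)
    fix y assume "y \<in> carrier S"
    then obtain x where x: "x \<in> carrier R" "y = h x" using S by blast
    then show "?fib y \<in> carrier (R Quot ?N)"
      using Q.closed fib by simp
    fix y' assume "y' \<in> carrier S"
    then obtain x' where x': "x' \<in> carrier R" "y' = h x'" using S by blast
    show "?fib (y \<oplus>\<^bsub>S\<^esub> y') = ?fib y \<oplus>\<^bsub>R Quot ?N\<^esub> ?fib y'"
      using x x' fib[of x] fib[of x'] fib[of "x \<oplus> x'"] Q.add by simp
    show "?fib (y \<otimes>\<^bsub>S\<^esub> y') = ?fib y \<otimes>\<^bsub>R Quot ?N\<^esub> ?fib y'"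
      using x x' fib[of x] fib[of x'] fib[of "x \<otimes> x'"] Q.mult by simp
  next
    have "inj_on ?fib (carrier S)"
      using S by (intro inj_onI) blast
    moreover have "?fib ` carrier S = carrier (R Quot ?N)"
    proof -
      have "?fib ` carrier S = (\<lambda>x. ?fib (h x)) ` carrier R"
        unfolding surj[symmetric] by (rule image_image)
      also have "\<dots> = (\<lambda>x. ?N +> x) ` carrier R"
        by (rule image_cong[OF refl fib])
      also have "\<dots> = carrier (R Quot ?N)"
        by (rule R.coset_hom(2)[OF two_sided_ideal_kernel])
      finally show ?thesis .
    qed
    ultimately show "bij_betw ?fib (carrier S) (carrier (R Quot ?N))"
      by (simp add: bij_betw_def)
  qed
qed

text \<open>
  The extension is \<open>f a = q (u a)\<close>, where \<open>q u\<close> is the identity of \<open>S\<close>. It agrees with \<open>q\<close> on \<open>I\<close>, as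
  \<open>q (u x) = q u q x = q x\<close> there, and hence is onto.
\<close>

lemma (in nonunital_ring) extend_hom_from_ideal:
  assumes I: "two_sided_ideal I R"
    and q: "nonunital_ring_hom (R\<lparr>carrier := I\<rparr>) S q" "q ` I = carrier S"
    and "unital S"
  obtains f where "nonunital_ring_hom R S f" "f ` carrier R = carrier S"
proof -
  interpret q: nonunital_ring_hom "R\<lparr>carrier := I\<rparr>" S q by fact
  have IR: "x \<in> carrier R" if "x \<in> I" for x
    using that I by (auto simp: two_sided_ideal_def dest: additive_subgroup.a_subset)
  have IL: "x \<otimes> a \<in> I" "a \<otimes> x \<in> I" if "x \<in> carrier R" "a \<in> I" for a x
    using that I by (auto simp: two_sided_ideal_def)
  have q_mult: "q (x \<otimes> y) = q x \<otimes>\<^bsub>S\<^esub> q y" if "x \<in> I" "y \<in> I" for x y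
    using that q.mult by simp
  have q_closed: "q x \<in> carrier S" if "x \<in> I" for x
    using that q(2) by blast
  obtain u where u: "u \<in> I"
    and q_u: "\<And>y. y \<in> carrier S \<Longrightarrow> q u \<otimes>\<^bsub>S\<^esub> y = y" "\<And>y. y \<in> carrier S \<Longrightarrow> y \<otimes>\<^bsub>S\<^esub> q u = y"
    using \<open>unital S\<close> q(2) unfolding unital_def by (metis imageE)
  define f where "f x = q (u \<otimes> x)" for x
  have f_mult: "f (a \<otimes> b) = f a \<otimes>\<^bsub>S\<^esub> f b" if ab: "a \<in> carrier R" "b \<in> carrier R" for a b
  proof -
    \<comment> \<open>\<open>q\<close> may only be split at factors in \<open>I\<close>. The factor \<open>q u\<close> added on the right turns \<open>b\<close> into
      \<open>b u\<close>, which lies in \<open>I\<close>; a second \<open>q u\<close> inserted in front of \<open>q (b u)\<close> then combines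
      with it to \<open>q (u b) q u = f b\<close>.\<close>
    have "f (a \<otimes> b) = q (u \<otimes> (a \<otimes> b)) \<otimes>\<^bsub>S\<^esub> q u"
      using ab u by (simp add: f_def q_u q_closed IL)
    also have "\<dots> = q ((u \<otimes> a) \<otimes> (b \<otimes> u))"
      using ab u by (simp add: IL IR m_assoc flip: q_mult)
    also have "\<dots> = q (u \<otimes> a) \<otimes>\<^bsub>S\<^esub> (q u \<otimes>\<^bsub>S\<^esub> q (b \<otimes> u))"
      using ab u by (simp add: IL q_mult q_u q_closed)
    also have "\<dots> = q (u \<otimes> a) \<otimes>\<^bsub>S\<^esub> (q (u \<otimes> b) \<otimes>\<^bsub>S\<^esub> q u)"
      using ab u by (simp add: IL IR m_assoc flip: q_mult)
    also have "\<dots> = f a \<otimes>\<^bsub>S\<^esub> f b"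
      using ab u by (simp add: f_def q_u q_closed IL)
    finally show ?thesis .
  qed
  have f_q: "f x = q x" if "x \<in> I" for x
    using that u by (simp add: f_def q_mult q_u q_closed)
  show thesis
  proof
    show "nonunital_ring_hom R S f"
    proof (intro nonunital_ring_hom.intro nonunital_ring_axioms q.S.nonunital_ring_axioms
        nonunital_ring_hom_axioms.intro f_mult)
      fix x y assume xy: "x \<in> carrier R" "y \<in> carrier R"
      show "f (x \<oplus> y) = f x \<oplus>\<^bsub>S\<^esub> f y"
        using xy u q.add[of "u \<otimes> x" "u \<otimes> y"] by (simp add: f_def IL IR r_distr)
    qed (use u in \<open>auto simp: f_def q_closed IL\<close>)
    show "f ` carrier R = carrier S"
    proof
      show "f ` carrier R \<subseteq> carrier S"
        using u by (auto simp: f_def q_closed IL)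
      show "carrier S \<subseteq> f ` carrier R"
      proof
        fix y assume "y \<in> carrier S"
        then obtain x where "x \<in> I" "y = q x"
          using q(2) by blast
        then show "y \<in> f ` carrier R"
          using f_q IR by (intro image_eqI[of _ _ x]) simp_all
      qed
    qed
  qed
qed

theorem (in nonunital_ring) has_unital_pi_simple_quotient_if_ideal_has:
  assumes I: "two_sided_ideal I R"
    and "has_unital_pi_simple_quotient (R\<lparr>carrier := I\<rparr>)"
  shows "has_unital_pi_simple_quotient R"
proof -
  let ?I = "R\<lparr>carrier := I\<rparr>"
  interpret I: nonunital_ring ?I
    by (rule two_sided_ideal_nonunital_ring[OF I])
  obtain J where J: "two_sided_ideal J ?I" and Q: "unital (?I Quot J)" "simple_ring (?I Quot J)"
    "purely_infinite (?I Quot J)"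
    using assms(2) by (auto simp: has_unital_pi_simple_quotient_def)
  have "(\<lambda>x. J +>\<^bsub>?I\<^esub> x) ` I = carrier (?I Quot J)"
    using I.coset_hom(2)[OF J] by simp
  then obtain f where f: "nonunital_ring_hom R (?I Quot J) f"
    and surj: "f ` carrier R = carrier (?I Quot J)"
    using extend_hom_from_ideal[OF I I.coset_hom(1)[OF J] _ Q(1)] by metis
  interpret f: nonunital_ring_hom R "?I Quot J" f by fact
  interpret iso: nonunital_ring_iso "?I Quot J" "R Quot a_kernel R (?I Quot J) f"
    "\<lambda>y. {x \<in> carrier R. f x = y}"
    by (rule f.Quot_kernel_iso[OF surj])
  show ?thesis
    unfolding has_unital_pi_simple_quotient_def
    using f.two_sided_ideal_kernel Q iso.unital_transfer iso.simple_ring_transfer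
      iso.purely_infinite_transfer by blast
qed


section \<open>The Leavitt path algebra as a non-unital ring\<close>

lemma free_algebra_simps [simp]:
  "mult (free_algebra K G) = (*)" "add (free_algebra K G) = (+)" "zero (free_algebra K G) = 0"
  by (simp_all add: free_algebra_def)

lemma mem_free_algebra_iff:
  "p \<in> carrier (free_algebra K G) \<longleftrightarrow>
     (\<forall>w\<in>Poly_Mapping.keys p. letters w \<noteq> [] \<and> set (letters w) \<subseteq> G)"
  by (simp add: free_algebra_def)

lemma free_algebra_closed:
  shows zero_mem_free_algebra: "0 \<in> carrier (free_algebra K G)"
    and add_mem_free_algebra: "\<lbrakk>p \<in> carrier (free_algebra K G); q \<in> carrier (free_algebra K G)\<rbrakk> \<Longrightarrow>
      p + q \<in> carrier (free_algebra K G)"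
    and diff_mem_free_algebra: "\<lbrakk>p \<in> carrier (free_algebra K G); q \<in> carrier (free_algebra K G)\<rbrakk> \<Longrightarrow>
      p - q \<in> carrier (free_algebra K G)"
    and mult_mem_free_algebra: "\<lbrakk>p \<in> carrier (free_algebra K G); q \<in> carrier (free_algebra K G)\<rbrakk> \<Longrightarrow>
      p * q \<in> carrier (free_algebra K G)"
    and map_mem_free_algebra: "p \<in> carrier (free_algebra K G) \<Longrightarrow>
      Poly_Mapping.map ((*) c) p \<in> carrier (free_algebra K G)"
    and monom_mem_free_algebra: "\<lbrakk>gs \<noteq> []; set gs \<subseteq> G\<rbrakk> \<Longrightarrow> monom gs \<in> carrier (free_algebra K G)"
proof -
  show "0 \<in> carrier (free_algebra K G)"
    by (simp add: mem_free_algebra_iff)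
  show "p + q \<in> carrier (free_algebra K G)"
    if "p \<in> carrier (free_algebra K G)" "q \<in> carrier (free_algebra K G)"
    using that Poly_Mapping.keys_add[of p q] unfolding mem_free_algebra_iff by blast
  show "p - q \<in> carrier (free_algebra K G)"
    if "p \<in> carrier (free_algebra K G)" "q \<in> carrier (free_algebra K G)"
    using that Poly_Mapping.keys_diff[of p q] unfolding mem_free_algebra_iff by blast
  show "p * q \<in> carrier (free_algebra K G)"
    if "p \<in> carrier (free_algebra K G)" "q \<in> carrier (free_algebra K G)"
    unfolding mem_free_algebra_iff
  proof
    fix w assume "w \<in> Poly_Mapping.keys (p * q)"
    then obtain a b where "w = a + b" "a \<in> Poly_Mapping.keys p" "b \<in> Poly_Mapping.keys q"
      using Poly_Mapping.keys_mult[of p q] by blast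
    then show "letters w \<noteq> [] \<and> set (letters w) \<subseteq> G"
      using that by (auto simp: mem_free_algebra_iff plus_free_monoid_def)
  qed
  show "Poly_Mapping.map ((*) c) p \<in> carrier (free_algebra K G)"
    if "p \<in> carrier (free_algebra K G)"
    using that by (auto simp: mem_free_algebra_iff in_keys_iff Poly_Mapping.map.rep_eq)
  show "monom gs \<in> carrier (free_algebra K G)" if "gs \<noteq> []" "set gs \<subseteq> G"
    using that by (simp add: mem_free_algebra_iff monom_def)
qed

lemma sum_mem_free_algebra:
  assumes "\<And>i. i \<in> A \<Longrightarrow> f i \<in> carrier (free_algebra K G)"
  shows "sum f A \<in> carrier (free_algebra K G)"
  using assms by (induction A rule: infinite_finite_induct) (auto intro: free_algebra_closed)

lemma nonunital_ring_free_algebra: "nonunital_ring (free_algebra K G)"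
proof (intro nonunital_ring.intro nonunital_ring_axioms.intro)
  show "abelian_group (free_algebra K G)"
  proof (rule abelian_groupI)
    fix p assume "p \<in> carrier (free_algebra K G)"
    then have "0 - p \<in> carrier (free_algebra K G)"
      by (intro free_algebra_closed)
    then show "\<exists>q\<in>carrier (free_algebra K G). q \<oplus>\<^bsub>free_algebra K G\<^esub> p = \<zero>\<^bsub>free_algebra K G\<^esub>"
      by (intro bexI[of _ "0 - p"]) simp_all
  qed (auto simp: ac_simps free_algebra_closed)
qed (auto simp: free_algebra_closed algebra_simps)

context wf_digraph
begin

lemma lpa_gens_simps [simp]:
  "Vertex v \<in> lpa_gens G \<longleftrightarrow> v \<in> verts G"
  "Edge e \<in> lpa_gens G \<longleftrightarrow> e \<in> arcs G"
  "Ghost e \<in> lpa_gens G \<longleftrightarrow> e \<in> arcs G"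
  by (auto simp: lpa_gens_def)

text \<open>
  Without this inclusion no ideal of the free algebra would contain the relations, and \<open>lpa_ideal\<close>
  would be an empty intersection, that is, the whole type.
\<close>

lemma lpa_relations_subset:
  "lpa_relations K G \<subseteq> carrier (free_algebra K (lpa_gens G))"
proof -
  have sum: "(\<Sum>e\<in>out_arcs G v. monom [Edge e, Ghost e]) \<in> carrier (free_algebra K (lpa_gens G))" for v
    by (rule sum_mem_free_algebra, rule monom_mem_free_algebra) auto
  show ?thesis
    unfolding lpa_relations_def
    by (auto intro!: free_algebra_closed sum)
qed

lemma two_sided_ideal_lpa_ideal:
  "two_sided_ideal (lpa_ideal K G) (free_algebra K (lpa_gens G))"
proof -
  interpret F: nonunital_ring "free_algebra K (lpa_gens G)"
    by (rule nonunital_ring_free_algebra)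
  show ?thesis
    unfolding generated_algebra_ideal_def
    using F.two_sided_ideal_carrier lpa_relations_subset map_mem_free_algebra
    by (intro F.two_sided_ideal_Inter) blast+
qed

lemma nonunital_ring_leavitt_path_algebra: "nonunital_ring (leavitt_path_algebra K G)"
  unfolding leavitt_path_algebra_def
  by (intro nonunital_ring.nonunital_ring_Quot nonunital_ring_free_algebra
      two_sided_ideal_lpa_ideal)

lemma lpa_vertex_closed:
  assumes "v \<in> verts G"
  shows "lpa_vertex K G v \<in> carrier (leavitt_path_algebra K G)"
proof -
  have "monom [Vertex v] \<in> carrier (free_algebra K (lpa_gens G))"
    using assms by (intro monom_mem_free_algebra) auto
  then show ?thesis
    unfolding lpa_vertex_def leavitt_path_algebra_def
    by (rule nonunital_ring_hom.closed[OF nonunital_ring.coset_hom(1)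
        [OF nonunital_ring_free_algebra two_sided_ideal_lpa_ideal]])
qed

lemma two_sided_ideal_vertex_ideal:
  assumes "H \<subseteq> verts G"
  shows "two_sided_ideal (vertex_ideal K G H) (leavitt_path_algebra K G)"
  unfolding vertex_ideal_def using assms lpa_vertex_closed
  by (intro nonunital_ring.two_sided_ideal_generated_ideal nonunital_ring_leavitt_path_algebra) auto

lemma hs_closure_subset_verts:
  assumes "Y \<subseteq> verts G"
  shows "hs_closure G Y \<subseteq> verts G"
proof -
  have "hereditary G (verts G)" "saturated G (verts G)"
    by (auto simp: hereditary_def saturated_def connects_def dest: awalk_last_in_verts)
  then show ?thesis
    using assms unfolding hs_closure_def by blast
qed

end

theorem proposition5p4:
  fixes K :: "'k::field itself"
    and E :: "('v, 'e) pre_digraph"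
    and X0 X :: "'v set"
  assumes "wf_digraph E"
    and "countable (verts E)" and "countable (arcs E)"
    and "row_finite E"
    and "condition_K E"
    and "X0 = {v \<in> verts E. \<exists>e\<in>arcs E. \<exists>f\<in>arcs E. e \<noteq> f \<and> tail E e = v \<and> tail E f = v \<and>
                 connects E (head E e) v \<and> connects E (head E f) v}"
    and "X = hs_closure E X0"
    and "\<not> has_unital_pi_simple_quotient (leavitt_path_algebra K E)"
  shows "\<not> has_unital_pi_simple_quotient (vertex_ideal_ring K E X)"
proof -
  interpret wf_digraph E by fact
  interpret L: nonunital_ring "leavitt_path_algebra K E"
    by (rule nonunital_ring_leavitt_path_algebra)
  have "X0 \<subseteq> verts E"
    using assms(6) by blast
  then have "X \<subseteq> verts E"
    using assms(7) hs_closure_subset_verts by blast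
  then have "two_sided_ideal (vertex_ideal K E X) (leavitt_path_algebra K E)"
    by (rule two_sided_ideal_vertex_ideal)
  then show ?thesis
    using L.has_unital_pi_simple_quotient_if_ideal_has assms(8)
    unfolding vertex_ideal_ring_def by blast
qed

end
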